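(* Let $(X,G)$ be a connected locally finite graph with a relative weight function $\mathbf{w}$, let $H\subseteq G$ be an acyclic subgraph and $<$ a linear ordering on the undirected edges of $G$, and let $M$ be the $\mathbf{w}$-maximal subforest of $G$ with fixed subforest $H$ and tiebreaker $<$. For any $G$-connected $G$-cycle-invariant $Y\subseteq X$, if $M|Y$ is disconnected, then every $M|Y$-component is $\mathbf{w}$-nonvanishing. In particular, if $Y$ is $\mathbf{w}$-nonvanishing, then so is every $M|Y$-component.
   Context: Graphs are simple and undirected; "connected" includes nonempty. $M|Y$ denotes the subgraph of $M$ induced on $Y$; $Y$ is $G$-connected if $G|Y$ is connected. A relative weight function assigns to each pair $(x,y)\in X^2$ a positive real $\mathbf{w}^y(x)=\mathbf{w}(x,y)$ with $\mathbf{w}(x,y)\mathbf{w}(y,z)=\mathbf{w}(x,z)$. Fix any basepoint $b\in X$; the notions below do not depend on it. A set $A\subseteq X$ is $\mathbf{w}$-nonvanishing if for some $\varepsilon>0$ infinitely many $x\in A$ have $\mathbf{w}^b(x)\ge\varepsilon$. For an edge $e=\{x,y\}$ put $\tilde{\mathbf{w}}(e):=\min\{\mathbf{w}^b(x),\mathbf{w}^b(y)\}$; define $e_1<_{\mathbf{w}}e_2$ iff $\tilde{\mathbf{w}}(e_1)<\tilde{\mathbf{w}}(e_2)$, or $\tilde{\mathbf{w}}(e_1)=\tilde{\mathbf{w}}(e_2)$ and $e_1<e_2$. The $\mathbf{w}$-maximal subforest $M$ ($H\subseteq M\subseteq G$, on vertex set $X$) is obtained from $G$ by deleting simultaneously from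 each simple cycle of $G$ the $<_{\mathbf{w}}$-least edge not in $H$. A subset $Y\subseteq X$ is $G$-cycle-invariant if whenever it contains (both endpoints of) an edge of a simple $G$-cycle, it contains the entire cycle. *)

theory Defs
  imports Complex_Main
begin

text \<open>
  A graph on vertex set \<open>X\<close> is given by its set of edges, each an unordered pair of distinct
  vertices, so that simplicity and undirectedness are built in. Subgraphs of \<open>(X, G)\<close> with vertex
  set \<open>X\<close> are subsets of \<open>G\<close>.
\<close>

definition simple_graph :: "'a set \<Rightarrow> 'a set set \<Rightarrow> bool" where
  "simple_graph X G \<longleftrightarrow> (\<forall>e\<in>G. e \<subseteq> X \<and> card e = 2)"

definition locally_finite :: "'a set \<Rightarrow> 'a set set \<Rightarrow> bool" where
  "locally_finite X G \<longleftrightarrow> (\<forall>x\<in>X. finite {e\<in>G. x \<in> e})"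

definition induced :: "'a set set \<Rightarrow> 'a set \<Rightarrow> 'a set set" (infixl "|`|" 70) where
  "M |`| Y = {e\<in>M. e \<subseteq> Y}"

definition adjacency :: "'a set set \<Rightarrow> ('a \<times> 'a) set" where
  "adjacency G = {(x, y). {x, y} \<in> G}"

definition connected_graph :: "'a set \<Rightarrow> 'a set set \<Rightarrow> bool" where
  "connected_graph X G \<longleftrightarrow> X \<noteq> {} \<and> (\<forall>x\<in>X. \<forall>y\<in>X. (x, y) \<in> (adjacency G)\<^sup>*)"

definition graph_components :: "'a set \<Rightarrow> 'a set set \<Rightarrow> 'a set set" where
  "graph_components X G = (\<lambda>x. {y\<in>X. (x, y) \<in> (adjacency G)\<^sup>*}) ` X"

text \<open>
  A simple cycle is represented by the list of its vertices in cyclic order, without repeating the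
  first vertex at the end.
\<close>

definition cycle_edges :: "'a list \<Rightarrow> 'a set set" where
  "cycle_edges c = {{c ! i, c ! (Suc i mod length c)} | i. i < length c}"

definition simple_cycle :: "'a set set \<Rightarrow> 'a list \<Rightarrow> bool" where
  "simple_cycle G c \<longleftrightarrow> 3 \<le> length c \<and> distinct c \<and> cycle_edges c \<subseteq> G"

definition acyclic_graph :: "'a set set \<Rightarrow> bool" where
  "acyclic_graph G \<longleftrightarrow> (\<nexists>c. simple_cycle G c)"

definition cycle_invariant :: "'a set set \<Rightarrow> 'a set \<Rightarrow> bool" where
  "cycle_invariant G Y \<longleftrightarrow>
    (\<forall>c. simple_cycle G c \<and> (\<exists>e\<in>cycle_edges c. e \<subseteq> Y) \<longrightarrow> set c \<subseteq> Y)"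

text \<open>
  For a relative weight function, \<open>w x y\<close> stands for $\mathbf{w}(x,y) = \mathbf{w}^y(x)$. The
  argument \<open>b\<close> below is the basepoint.
\<close>

definition relative_weight :: "'a set \<Rightarrow> ('a \<Rightarrow> 'a \<Rightarrow> real) \<Rightarrow> bool" where
  "relative_weight X w \<longleftrightarrow>
    (\<forall>x\<in>X. \<forall>y\<in>X. 0 < w x y) \<and> (\<forall>x\<in>X. \<forall>y\<in>X. \<forall>z\<in>X. w x y * w y z = w x z)"

definition nonvanishing :: "('a \<Rightarrow> 'a \<Rightarrow> real) \<Rightarrow> 'a \<Rightarrow> 'a set \<Rightarrow> bool" where
  "nonvanishing w b A \<longleftrightarrow> (\<exists>\<epsilon>>0. infinite {x\<in>A. \<epsilon> \<le> w x b})"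

definition edge_weight :: "('a \<Rightarrow> 'a \<Rightarrow> real) \<Rightarrow> 'a \<Rightarrow> 'a set \<Rightarrow> real" where
  "edge_weight w b e = Min ((\<lambda>x. w x b) ` e)"

definition edge_less ::
  "('a \<Rightarrow> 'a \<Rightarrow> real) \<Rightarrow> 'a \<Rightarrow> ('a set \<times> 'a set) set \<Rightarrow> 'a set \<Rightarrow> 'a set \<Rightarrow> bool" where
  "edge_less w b tie e\<^sub>1 e\<^sub>2 \<longleftrightarrow>
    edge_weight w b e\<^sub>1 < edge_weight w b e\<^sub>2 \<or>
    edge_weight w b e\<^sub>1 = edge_weight w b e\<^sub>2 \<and> (e\<^sub>1, e\<^sub>2) \<in> tie"

definition least_edge ::
  "('a \<Rightarrow> 'a \<Rightarrow> real) \<Rightarrow> 'a \<Rightarrow> ('a set \<times> 'a set) set \<Rightarrow> 'a set set \<Rightarrow> 'a set \<Rightarrow> bool" where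
  "least_edge w b tie S e \<longleftrightarrow> e \<in> S \<and> (\<forall>f\<in>S. f \<noteq> e \<longrightarrow> edge_less w b tie e f)"

definition maximal_subforest ::
  "'a set set \<Rightarrow> ('a \<Rightarrow> 'a \<Rightarrow> real) \<Rightarrow> 'a \<Rightarrow> 'a set set \<Rightarrow> ('a set \<times> 'a set) set \<Rightarrow> 'a set set" where
  "maximal_subforest G w b H tie =
    G - {e. \<exists>c. simple_cycle G c \<and> least_edge w b tie (cycle_edges c - H) e}"

end

theory Submission
  imports Defs "HOL-Number_Theory.Cong"
begin

text \<open>
  Suppose \<open>C\<close> is an \<open>M |`| Y\<close>-component other than \<open>Y\<close> that is not nonvanishing. The edges of
  \<open>G |`| Y\<close> leaving \<open>C\<close> are not in \<open>M\<close>, and there is at least one. The weight of such an edge is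
  at most that of its endpoint in \<open>C\<close>, so by local finiteness only finitely many exceed a given
  positive bound, and there is a maximal one, \<open>e\<close>. A cycle witnessing the removal of \<open>e\<close> lies in
  \<open>Y\<close> and leaves \<open>C\<close> a second time, through an edge larger than \<open>e\<close> (not in \<open>H\<close>, as \<open>H \<subseteq> M\<close>),
  which is a contradiction.
\<close>

definition edge_boundary :: "'a set set \<Rightarrow> 'a set \<Rightarrow> 'a set set" where
  "edge_boundary E C = {e\<in>E. e \<inter> C \<noteq> {} \<and> \<not> e \<subseteq> C}"

lemma sym_adjacency_rtrancl: "sym ((adjacency E)\<^sup>*)"
  by (intro sym_rtrancl symI) (auto simp: adjacency_def insert_commute)

text \<open>If no edge crossed, membership in \<open>C\<close> would propagate along a path from a
  vertex of \<open>C\<close> to a vertex of \<open>Y\<close> outside it.\<close>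

lemma edge_boundary_nonempty:
  assumes "connected_graph Y E" "C \<subseteq> Y" "C \<noteq> {}" "C \<noteq> Y"
  shows "edge_boundary E C \<noteq> {}"
proof
  assume empty: "edge_boundary E C = {}"
  obtain x y where x: "x \<in> C" and y: "y \<in> Y" "y \<notin> C"
    using assms by blast
  have "(x, y) \<in> (adjacency E)\<^sup>*"
    using assms x y by (auto simp: connected_graph_def)
  then have "y \<in> C"
  proof induction
    case base
    show ?case by (fact x)
  next
    case (step u v)
    then show ?case
      using empty by (auto simp: adjacency_def edge_boundary_def)
  qed
  with y show False by blast
qed

text \<open>A component is closed under adjacency, and a crossing edge consists of just one vertex
  inside and one outside \<open>C\<close>.\<close>

lemma component_boundary_disjoint:
  assumes "C \<in> graph_components Y (M |`| Y)" "simple_graph X M"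
  shows "edge_boundary (M |`| Y) C = {}"
proof (rule ccontr)
  assume "edge_boundary (M |`| Y) C \<noteq> {}"
  then obtain e u v where e: "e \<in> M" "e \<subseteq> Y" and uv: "u \<in> e" "u \<in> C" "v \<in> e" "v \<notin> C"
    by (auto simp: edge_boundary_def induced_def)
  have "card e = 2"
    using assms e by (auto simp: simple_graph_def)
  then have "e = {u, v}"
    using uv by (auto simp: card_2_iff)
  then have "(u, v) \<in> adjacency (M |`| Y)"
    using e by (auto simp: adjacency_def induced_def)
  moreover obtain x where "C = {y\<in>Y. (x, y) \<in> (adjacency (M |`| Y))\<^sup>*}"
    using assms by (auto simp: graph_components_def)
  ultimately have "v \<in> C"
    using uv e by (auto intro: rtrancl_into_rtrancl)
  with uv show False by blast
qed

text \<open>This covers the one component that the boundary argument cannot treat, namely all of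
  \<open>Y\<close>.\<close>

lemma connected_graph_if_component_full:
  assumes "Y \<in> graph_components Y E"
  shows "connected_graph Y E"
proof -
  obtain x where x: "x \<in> Y" "Y = {y\<in>Y. (x, y) \<in> (adjacency E)\<^sup>*}"
    using assms by (auto simp: graph_components_def)
  have "(u, v) \<in> (adjacency E)\<^sup>*" if "u \<in> Y" "v \<in> Y" for u v
  proof -
    have "(x, u) \<in> (adjacency E)\<^sup>*" "(x, v) \<in> (adjacency E)\<^sup>*"
      using x that by blast+
    then show ?thesis
      by (meson rtrancl_trans symD sym_adjacency_rtrancl)
  qed
  with x show ?thesis by (auto simp: connected_graph_def)
qed

lemma component_subset:
  assumes "C \<in> graph_components Y E"
  shows "C \<subseteq> Y" and "C \<noteq> {}"
  using assms by (auto simp: graph_components_def)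

text \<open>Deleting \<open>e\<close> from the cycle leaves a path between its endpoints, which lie
  on different sides of \<open>C\<close>; that path must cross as well.\<close>

lemma cycle_second_boundary_edge:
  assumes "3 \<le> length c" "distinct c" "e \<in> edge_boundary (cycle_edges c) C"
  shows "\<exists>f\<in>edge_boundary (cycle_edges c) C. f \<noteq> e"
proof -
  define n where "n = length c"
  obtain i where i: "i < n" "e = {c ! i, c ! (Suc i mod n)}"
    and cross: "c ! i \<in> C \<longleftrightarrow> c ! (Suc i mod n) \<notin> C"
    using assms(3) unfolding edge_boundary_def cycle_edges_def n_def by auto
  \<comment> \<open>The cycle is renumbered to start just after \<open>e\<close>: the remaining path
    runs from \<open>g 0\<close> to \<open>g (n - 1)\<close>, and \<open>e\<close> closes it
    up.\<close>
  define g where "g k = c ! ((Suc i + k) mod n)" for k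
  have n: "3 \<le> n" using assms by (simp add: n_def)
  have "(Suc i + (n - 1)) mod n = i"
    using i n by simp
  then have g_last: "g (n - 1) = c ! i" by (simp add: g_def)
  have e: "e = {g 0, g (n - 1)}"
    using i g_last by (auto simp: g_def)
  have inj: "g k = g l \<longleftrightarrow> k = l" if "k < n" "l < n" for k l
  proof
    assume "g k = g l"
    moreover have "(Suc i + j) mod n < length c" for j
      using n by (simp flip: n_def)
    ultimately have "(Suc i + k) mod n = (Suc i + l) mod n"
      unfolding g_def using nth_eq_iff_index_eq[OF assms(2)] by blast
    then have "[k = l] (mod n)"
      unfolding cong_def[symmetric] cong_add_lcancel_nat .
    with that show "k = l" by (simp add: cong_def)
  qed simp
  have "\<exists>k<n - 1. (g k \<in> C) \<noteq> (g (Suc k) \<in> C)"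
  proof (rule ccontr)
    assume "\<not> ?thesis"
    then have "k \<le> n - 1 \<Longrightarrow> (g k \<in> C) = (g 0 \<in> C)" for k
      by (induction k) auto
    from this[of "n - 1"] show False
      using cross g_last by (simp add: g_def)
  qed
  then obtain k where k: "k < n - 1" "(g k \<in> C) \<noteq> (g (Suc k) \<in> C)" by blast
  define j where "j = (Suc i + k) mod n"
  have "j < n" "g k = c ! j" "g (Suc k) = c ! (Suc j mod n)"
    using n by (simp_all add: j_def g_def mod_Suc_eq)
  then have "{g k, g (Suc k)} \<in> cycle_edges c"
    by (auto simp: cycle_edges_def n_def)
  with k have "{g k, g (Suc k)} \<in> edge_boundary (cycle_edges c) C"
    by (auto simp: edge_boundary_def)
  moreover have "{g k, g (Suc k)} \<noteq> e"
  proof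
    assume "{g k, g (Suc k)} = e"
    then consider "g k = g 0" "g (Suc k) = g (n - 1)" | "g (Suc k) = g 0"
      unfolding e doubleton_eq_iff by blast
    then show False
    proof cases
      \<comment> \<open>Here \<open>e\<close> would be the whole path, forcing \<open>n = 2\<close>;
        this is where cycle length at least 3 matters.\<close>
      case 1
      then have "k = 0" "Suc k = n - 1"
        using k(1) n inj[of k 0] inj[of "Suc k" "n - 1"] by linarith+
      with n show False by simp
    next
      case 2
      then show False
        using k(1) inj[of "Suc k" 0] by simp
    qed
  qed
  ultimately show ?thesis by (rule bexI[rotated])
qed

text \<open>Together with transitivity, this allows a maximal element to be chosen in a finite
  nonempty set of edges.\<close>

lemma edge_less_asym:
  assumes "trans tie" "irrefl tie"
  shows "asymp (edge_less w b tie)"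
proof (rule asympI)
  fix e f
  show "edge_less w b tie e f \<Longrightarrow> \<not> edge_less w b tie f e"
    using assms by (auto simp: edge_less_def dest: transD irreflD)
qed

lemma edge_less_trans:
  assumes "trans tie"
  shows "transp (edge_less w b tie)"
proof (rule transpI)
  fix e f g
  show "edge_less w b tie e f \<Longrightarrow> edge_less w b tie f g \<Longrightarrow> edge_less w b tie e g"
    using assms by (auto simp: edge_less_def dest: transD)
qed

lemma edge_weight_le:
  assumes "card e = 2" "x \<in> e"
  shows "edge_weight w b e \<le> w x b"
  using assms unfolding edge_weight_def by (auto simp: card_2_iff)

lemma edge_weight_pos:
  assumes "card e = 2" "\<And>x. x \<in> e \<Longrightarrow> 0 < w x b"
  shows "0 < edge_weight w b e"
  using assms unfolding edge_weight_def by (auto simp: card_2_iff)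

text \<open>Assuming \<open>C \<noteq> Y\<close> instead of disconnectedness lets both halves of the
  theorem follow from this one statement.\<close>

lemma proper_component_nonvanishing:
  assumes G: "simple_graph X G" and "locally_finite X G"
    and "relative_weight X w" and "b \<in> X"
    and "H \<subseteq> G" and tie: "trans tie" "irrefl tie"
    and M: "M = maximal_subforest G w b H tie"
    and "Y \<subseteq> X" and "connected_graph Y (G |`| Y)" and inv: "cycle_invariant G Y"
    and C: "C \<in> graph_components Y (M |`| Y)" "C \<noteq> Y"
  shows "nonvanishing w b C"
proof (rule ccontr)
  assume vanishing: "\<not> nonvanishing w b C"
  define B where "B = edge_boundary (G |`| Y) C"
  have "M \<subseteq> G" by (auto simp: M maximal_subforest_def)
  with G have "simple_graph X M" by (auto simp: simple_graph_def)
  with C have BM: "B \<inter> M = {}"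
    using component_boundary_disjoint[of C Y M X]
    by (auto simp: B_def edge_boundary_def induced_def)
  \<comment> \<open>A deleted edge is least in \<open>cycle_edges c - H\<close>, so it never belongs
    to \<open>H\<close>.\<close>
  have "H \<subseteq> M"
    using \<open>H \<subseteq> G\<close> by (auto simp: M maximal_subforest_def least_edge_def)
  have B: "e \<in> G" "e \<subseteq> Y" "e \<inter> C \<noteq> {}" "card e = 2" "e \<subseteq> X" if "e \<in> B" for e
    using that G by (auto simp: B_def edge_boundary_def induced_def simple_graph_def)
  obtain e0 where e0: "e0 \<in> B"
    using edge_boundary_nonempty[of Y "G |`| Y" C] component_subset[OF C(1)] C(2) assms
    by (auto simp: B_def)
  \<comment> \<open>Taking the weight of an actual boundary edge as the threshold makes
    \<open>F\<close> below nonempty.\<close>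
  define \<epsilon> where "\<epsilon> = edge_weight w b e0"
  have "0 < \<epsilon>"
    unfolding \<epsilon>_def using B[OF e0] assms
    by (intro edge_weight_pos) (auto simp: relative_weight_def)
  define F where "F = {e\<in>B. \<epsilon> \<le> edge_weight w b e}"
  have "finite {x\<in>C. \<epsilon> \<le> w x b}"
    using vanishing \<open>0 < \<epsilon>\<close> by (auto simp: nonvanishing_def)
  moreover have "C \<subseteq> X"
    using component_subset[OF C(1)] \<open>Y \<subseteq> X\<close> by blast
  ultimately have "finite (\<Union>x\<in>{x\<in>C. \<epsilon> \<le> w x b}. {e\<in>G. x \<in> e})"
    using \<open>locally_finite X G\<close> by (auto simp: locally_finite_def)
  moreover have "F \<subseteq> (\<Union>x\<in>{x\<in>C. \<epsilon> \<le> w x b}. {e\<in>G. x \<in> e})"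
  proof
    fix e assume "e \<in> F"
    then have e: "e \<in> B" "\<epsilon> \<le> edge_weight w b e" by (auto simp: F_def)
    then obtain x where x: "x \<in> e" "x \<in> C" using B by blast
    with e B have "\<epsilon> \<le> w x b" by (meson edge_weight_le order_trans)
    with x e B show "e \<in> (\<Union>x\<in>{x\<in>C. \<epsilon> \<le> w x b}. {e\<in>G. x \<in> e})" by blast
  qed
  ultimately have "finite F" by (rule rev_finite_subset)
  moreover have "F \<noteq> {}" using e0 by (auto simp: F_def \<epsilon>_def)
  ultimately obtain e where e: "e \<in> F" "\<And>f. f \<in> F \<Longrightarrow> f \<noteq> e \<Longrightarrow> \<not> edge_less w b tie e f"
    using Finite_Set.bex_max_element[of F "edge_less w b tie"]
      edge_less_asym[OF tie] edge_less_trans[OF tie(1)]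
    by (meson asymp_on_subset transp_on_subset subset_UNIV)
  have "e \<in> B" using e by (simp add: F_def)
  then have "e \<in> G - M" using B BM by blast
  then obtain c where c: "simple_cycle G c" and least: "least_edge w b tie (cycle_edges c - H) e"
    by (auto simp: M maximal_subforest_def)
  have ec: "e \<in> cycle_edges c" using least by (simp add: least_edge_def)
  \<comment> \<open>Cycle invariance applies because \<open>e\<close> is itself an edge of
    \<open>c\<close> inside \<open>Y\<close>.\<close>
  then have "set c \<subseteq> Y"
    using inv c B \<open>e \<in> B\<close> unfolding cycle_invariant_def by blast
  moreover have "f \<subseteq> set c" if "f \<in> cycle_edges c" for f
    using that by (auto simp: cycle_edges_def intro!: nth_mem mod_less_divisor)
  ultimately have cY: "cycle_edges c \<subseteq> G |`| Y"
    using c by (fastforce simp: simple_cycle_def induced_def)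
  have "e \<in> edge_boundary (cycle_edges c) C"
    using ec \<open>e \<in> B\<close> by (auto simp: B_def edge_boundary_def)
  then obtain f where f: "f \<in> edge_boundary (cycle_edges c) C" "f \<noteq> e"
    using cycle_second_boundary_edge[of c e C] c by (auto simp: simple_cycle_def)
  then have "f \<in> B" using cY by (auto simp: B_def edge_boundary_def)
  then have "f \<notin> H" using BM \<open>H \<subseteq> M\<close> by blast
  then have less: "edge_less w b tie e f"
    using least f by (auto simp: least_edge_def edge_boundary_def)
  \<comment> \<open>\<open>F\<close> is upward closed in \<open>B\<close>: a larger edge weighs at
    least as much as \<open>e\<close>, hence at least \<epsilon>. So maximality within
    \<open>F\<close> already excludes \<open>f\<close>.\<close>
  then have "f \<in> F" using e(1) \<open>f \<in> B\<close> by (auto simp: F_def edge_less_def)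
  with e less f show False by blast
qed

theorem lemma3p4:
  fixes X Y :: "'a set" and G H M :: "'a set set"
    and w :: "'a \<Rightarrow> 'a \<Rightarrow> real" and b :: 'a
    and tie :: "('a set \<times> 'a set) set"
  assumes "simple_graph X G" and "connected_graph X G" and "locally_finite X G"
    and "relative_weight X w" and "b \<in> X"
    and "H \<subseteq> G" and "acyclic_graph H"
    and "strict_linear_order_on G tie"
    and "M = maximal_subforest G w b H tie"
    and "Y \<subseteq> X" and "connected_graph Y (G |`| Y)" and "cycle_invariant G Y"
  shows "(\<not> connected_graph Y (M |`| Y) \<longrightarrow>
            (\<forall>C\<in>graph_components Y (M |`| Y). nonvanishing w b C)) \<and>
         (nonvanishing w b Y \<longrightarrow>
            (\<forall>C\<in>graph_components Y (M |`| Y). nonvanishing w b C))"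
proof -
  have "trans tie" "irrefl tie"
    using assms(8) by (auto simp: strict_linear_order_on_def)
  then have "nonvanishing w b C" if "C \<in> graph_components Y (M |`| Y)" "C \<noteq> Y" for C
    using proper_component_nonvanishing[OF assms(1,3-6) _ _ assms(9-12)] that by blast
  \<comment> \<open>Only \<open>C = Y\<close> remains: it contradicts disconnectedness in the first
    half and is nonvanishing by hypothesis in the second.\<close>
  then show ?thesis
    by (metis connected_graph_if_component_full)
qed

end
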